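(* Let $k_1=0$, $k_2=0$ and $F<0$. Then there exists $\varepsilon=\varepsilon(F)>0$ such that for all $|m_1l_1-m_3l_3|<\varepsilon$ the system $$\dot\varphi_1=v_1,\qquad \dot v_1=\left(r_1-\frac{A_{12}}{A_{22}}r_2\right)\left(A_{11}-\frac{A_{12}^2}{A_{22}}\right)^{-1},\qquad \dot v_2=\left(r_2-\frac{A_{12}}{A_{11}}r_1\right)\left(A_{22}-\frac{A_{12}^2}{A_{11}}\right)^{-1}$$ with state variables $(\varphi_1,v_1,v_2)$ has a two-parameter family of periodic solutions.
   Context: This is the reduced system of the Ziegler pendulum (a planar double pendulum with point masses $m_1,m_2,m_3>0$, rod lengths $l_1,l_2,l_3>0$, a follower force of constant magnitude, with signed value $F$, stiffness $k_1$ of the spring between the rods) with zero stiffness $k_2=0$ of the spring at the pivot. Here $$A_{11}=m_1l_1^2+m_3l_3^2,$$ $$A_{12}=m_1l_1^2+m_3l_3^2+(m_1l_1-m_3l_3)l_2\cos\varphi_1,$$ $$A_{22}=(m_1+m_2+m_3)l_2^2+m_1l_1^2+m_3l_3^2+2(m_1l_1-m_3l_3)l_2\cos\varphi_1,$$ $$r_1=-k_1\varphi_1-(m_1l_1-m_3l_3)l_2v_2^2\sin\varphi_1,$$ $$r_2=-Fl_2\sin\varphi_1+(m_1l_1-m_3l_3)l_2v_1(v_1+2v_2)\sin\varphi_1,$$ with $k_1=0$. A two-parameter family of periodic solutions means: there are a nonempty open set $U\subset\mathbb{R}^2$ and a smooth injective immersion $\sigma:U\to\mathbb{R}^3$, transverse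 to the vector field of the system, such that for each $u\in U$ the solution through $\sigma(u)$ is non-constant and periodic, and distinct $u$ give distinct trajectories. *)

theory Defs
  imports "HOL-Analysis.Analysis"
begin

definition A11 :: "real \<Rightarrow> real \<Rightarrow> real \<Rightarrow> real \<Rightarrow> real" where
  "A11 m1 m3 l1 l3 = m1 * l1\<^sup>2 + m3 * l3\<^sup>2"

definition A12 :: "real \<Rightarrow> real \<Rightarrow> real \<Rightarrow> real \<Rightarrow> real \<Rightarrow> real \<Rightarrow> real" where
  "A12 m1 m3 l1 l2 l3 \<phi> = m1 * l1\<^sup>2 + m3 * l3\<^sup>2 + (m1 * l1 - m3 * l3) * l2 * cos \<phi>"

definition A22 :: "real \<Rightarrow> real \<Rightarrow> real \<Rightarrow> real \<Rightarrow> real \<Rightarrow> real \<Rightarrow> real \<Rightarrow> real" where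
  "A22 m1 m2 m3 l1 l2 l3 \<phi> =
     (m1 + m2 + m3) * l2\<^sup>2 + m1 * l1\<^sup>2 + m3 * l3\<^sup>2 + 2 * (m1 * l1 - m3 * l3) * l2 * cos \<phi>"

definition r1 :: "real \<Rightarrow> real \<Rightarrow> real \<Rightarrow> real \<Rightarrow> real \<Rightarrow> real \<Rightarrow> real \<Rightarrow> real \<Rightarrow> real" where
  "r1 k1 m1 m3 l1 l2 l3 \<phi> v2 = - k1 * \<phi> - (m1 * l1 - m3 * l3) * l2 * v2\<^sup>2 * sin \<phi>"

definition r2 :: "real \<Rightarrow> real \<Rightarrow> real \<Rightarrow> real \<Rightarrow> real \<Rightarrow> real \<Rightarrow> real \<Rightarrow> real \<Rightarrow> real \<Rightarrow> real" where
  "r2 F m1 m3 l1 l2 l3 \<phi> v1 v2 =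
     - F * l2 * sin \<phi> + (m1 * l1 - m3 * l3) * l2 * v1 * (v1 + 2 * v2) * sin \<phi>"

text \<open>The state is \<open>(\<phi>, v1, v2)\<close>, with the angle \<open>\<phi>\<close> in the real line (not modulo \<open>2 * pi\<close>).
  For positive masses and lengths the matrix \<open>(A11, A12; A12, A22)\<close> is positive definite,
  so no denominator below vanishes.\<close>

definition ziegler_field ::
  "real \<Rightarrow> real \<Rightarrow> real \<Rightarrow> real \<Rightarrow> real \<Rightarrow> real \<Rightarrow> real \<Rightarrow> real \<Rightarrow>
    real \<times> real \<times> real \<Rightarrow> real \<times> real \<times> real" where
  "ziegler_field F k1 m1 m2 m3 l1 l2 l3 = (\<lambda>(\<phi>, v1, v2).
     (let a11 = A11 m1 m3 l1 l3;
          a12 = A12 m1 m3 l1 l2 l3 \<phi>;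
          a22 = A22 m1 m2 m3 l1 l2 l3 \<phi>;
          s1 = r1 k1 m1 m3 l1 l2 l3 \<phi> v2;
          s2 = r2 F m1 m3 l1 l2 l3 \<phi> v1 v2
      in (v1,
          (s1 - a12 / a22 * s2) * inverse (a11 - a12\<^sup>2 / a22),
          (s2 - a12 / a11 * s1) * inverse (a22 - a12\<^sup>2 / a11))))"

text \<open>\<open>Ck_on k U f\<close> says that \<open>f\<close> is of class \<open>C^k\<close> on \<open>U\<close>; it is meant for open \<open>U\<close> and a
  finite-dimensional domain, where it suffices to iterate directional derivatives.\<close>

primrec Ck_on :: "nat \<Rightarrow> 'a::euclidean_space set \<Rightarrow> ('a \<Rightarrow> 'b::real_normed_vector) \<Rightarrow> bool" where
  "Ck_on 0 U f \<longleftrightarrow> continuous_on U f"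
| "Ck_on (Suc k) U f \<longleftrightarrow>
     (\<forall>x\<in>U. f differentiable (at x)) \<and>
     (\<forall>v. Ck_on k U (\<lambda>x. frechet_derivative f (at x) v))"

definition smooth_map_on :: "'a::euclidean_space set \<Rightarrow> ('a \<Rightarrow> 'b::real_normed_vector) \<Rightarrow> bool" where
  "smooth_map_on U f \<longleftrightarrow> (\<forall>k. Ck_on k U f)"

definition immersion_on :: "'a::euclidean_space set \<Rightarrow> ('a \<Rightarrow> 'b::real_normed_vector) \<Rightarrow> bool" where
  "immersion_on U f \<longleftrightarrow> (\<forall>x\<in>U. f differentiable (at x) \<and> inj (frechet_derivative f (at x)))"

definition transverse_on ::
  "'a::euclidean_space set \<Rightarrow> ('a \<Rightarrow> 'b::real_normed_vector) \<Rightarrow> ('b \<Rightarrow> 'b) \<Rightarrow> bool" where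
  "transverse_on U f X \<longleftrightarrow>
     (\<forall>x\<in>U. span (insert (X (f x)) (range (frechet_derivative f (at x)))) = UNIV)"

definition is_solution :: "('b::real_normed_vector \<Rightarrow> 'b) \<Rightarrow> (real \<Rightarrow> 'b) \<Rightarrow> bool" where
  "is_solution X \<gamma> \<longleftrightarrow> (\<forall>t. (\<gamma> has_vector_derivative X (\<gamma> t)) (at t))"

definition periodic_curve :: "(real \<Rightarrow> 'b) \<Rightarrow> bool" where
  "periodic_curve \<gamma> \<longleftrightarrow> (\<exists>T>0. \<forall>t. \<gamma> (t + T) = \<gamma> t)"

text \<open>Here \<open>\<gamma> u\<close> is the solution through \<open>\<sigma> u\<close>; it is unique for a smooth field \<open>X\<close>.\<close>

definition has_two_parameter_family_of_periodic_solutions ::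
  "(real \<times> real \<times> real \<Rightarrow> real \<times> real \<times> real) \<Rightarrow> bool" where
  "has_two_parameter_family_of_periodic_solutions X \<longleftrightarrow>
     (\<exists>(U :: (real \<times> real) set) (\<sigma> :: real \<times> real \<Rightarrow> real \<times> real \<times> real)
        (\<gamma> :: real \<times> real \<Rightarrow> real \<Rightarrow> real \<times> real \<times> real).
        open U \<and> U \<noteq> {} \<and>
        smooth_map_on U \<sigma> \<and> inj_on \<sigma> U \<and> immersion_on U \<sigma> \<and> transverse_on U \<sigma> X \<and>
        (\<forall>u\<in>U. is_solution X (\<gamma> u) \<and> \<gamma> u 0 = \<sigma> u \<and>
                periodic_curve (\<gamma> u) \<and> \<not> \<gamma> u constant_on UNIV) \<and>
        inj_on (\<lambda>u. range (\<gamma> u)) U)"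

end

theory Submission
  imports Defs
begin

text \<open>
  With \<open>k1 = 0\<close> both generalised forces \<open>r1\<close> and \<open>r2\<close> carry the factor \<open>sin \<phi>\<close>, while all other
  dependence on \<open>\<phi>\<close> is through \<open>cos \<phi>\<close>. Hence both accelerations are odd about \<open>c = 0\<close> and about
  \<open>c = pi\<close>, and the field is reversible: if \<open>y\<close> is a solution, then so is the curve obtained from it
  by reflecting \<open>\<phi>\<close> at \<open>c\<close>, keeping the velocities, and reversing time. The fixed set of this
  reflection is the plane \<open>\<phi> = c\<close>. An orbit that starts on this plane and meets it again is mapped to
  itself by two such reversals, whose composition is a time shift, so it is periodic
  (\<open>solution_symmetric\<close>, \<open>closes_up\<close>). As the plane is two-dimensional, it remains to find an open set
  of launch points whose orbits return.

  Orbits return near a point \<open>(c, 0, w)\<close> at which the force is restoring, that is, the first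
  acceleration is \<open>- sin (\<phi> - c)\<close> times a factor that is positive there. By Sturm comparison with a
  harmonic oscillator the return takes at most half a period of the latter
  (\<open>returns_within_half_period\<close>), and an orbit with small launch speed stays close to \<open>(c, 0, w)\<close> for
  that long (\<open>stays_in_box\<close>).

  Put \<open>\<delta> = m1 * l1 - m3 * l3\<close>. For \<open>\<delta> \<ge> 0\<close> the force is restoring at \<open>(0, 0, 0)\<close>, since \<open>F < 0\<close>. For
  \<open>\<delta> < 0\<close> it is restoring at \<open>(pi, 0, w)\<close> for large \<open>w\<close>: there the centrifugal term, proportional to
  \<open>\<bar>\<delta>\<bar> * w\<^sup>2\<close>, dominates (\<open>family_exists\<close>). Because the choice of \<open>w\<close> may depend on the masses and
  lengths, \<open>\<epsilon>\<close> does not have to, and it can be taken to be 1.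

  Existence and uniqueness of solutions are proved for globally Lipschitz fields
  (\<open>lipschitz_field_has_global_solution\<close>, \<open>lipschitz_field_solution_unique\<close>) and applied to the field
  with its arguments clipped to a box around \<open>(c, 0, w)\<close>; the orbits found stay in this box.
\<close>

section \<open>Globally Lipschitz autonomous differential equations\<close>

lemma antiderivative_on_line:
  fixes g :: "real \<Rightarrow> 'a::euclidean_space"
  assumes "continuous_on UNIV g"
  shows "\<exists>F. F 0 = 0 \<and> (\<forall>t. (F has_vector_derivative g t) (at t))"
proof -
  have "isCont g x" for x
    using assms by (simp add: continuous_on_eq_continuous_at)
  then obtain F where "\<And>x. (F has_vector_derivative g x) (at x)"
    using einterval_antiderivative[of "-\<infinity>" "\<infinity>" g] by auto
  then have "((\<lambda>t. F t - F 0) has_vector_derivative g t) (at t)" for t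
    by (auto intro!: derivative_eq_intros)
  then show ?thesis
    by (intro exI[of _ "\<lambda>t. F t - F 0"]) auto
qed

lemma has_vector_derivative_reflect:
  assumes "(F has_vector_derivative F') (at (s - t))"
  shows "((\<lambda>t. F (s - t)) has_vector_derivative - F') (at t)"
proof -
  have "((\<lambda>t. s - t) has_vector_derivative -1) (at t)"
    by (auto intro!: derivative_eq_intros)
  then show ?thesis
    using vector_diff_chain_at[of "\<lambda>t. s - t" "-1" t F F'] assms by (simp add: o_def)
qed

text \<open>Integrating the majorant \<open>exp (K * s)\<close> gains the factor \<open>1 / K\<close>, which becomes small for
  large \<open>K\<close>; this is what turns the Picard operator into a contraction for an exponentially
  weighted norm on the whole line.\<close>

lemma exponential_growth_integrates:
  fixes F :: "real \<Rightarrow> 'a::real_normed_vector"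
  assumes "K > 0" "F 0 = 0"
    and F: "\<And>t. (F has_vector_derivative g t) (at t)"
    and g: "\<And>t. norm (g t) \<le> M * exp (K * \<bar>t\<bar>)"
  shows "norm (F t) \<le> M / K * exp (K * \<bar>t\<bar>)"
proof -
  have "M \<ge> 0"
    using order_trans[OF norm_ge_zero g[of 0]] by simp
  have forward: "norm (G b) \<le> M / K * exp (K * b)"
    if "b > 0" "G 0 = 0" and G: "\<And>t. (G has_vector_derivative g' t) (at t)"
      and g': "\<And>t. t > 0 \<Longrightarrow> norm (g' t) \<le> M * exp (K * t)"
    for b and G g' :: "real \<Rightarrow> 'a"
  proof -
    have "continuous_on {0..b} G"
      by (rule continuous_on_vector_derivative) (blast intro: has_vector_derivative_at_within G)
    moreover have "((\<lambda>t. M / K * exp (K * t)) has_vector_derivative M * exp (K * x)) (at x)" for x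
      using \<open>K > 0\<close>
      by (auto simp flip: has_real_derivative_iff_has_vector_derivative
          intro!: derivative_eq_intros)
    moreover have "continuous_on {0..b} (\<lambda>t. M / K * exp (K * t))"
      by (intro continuous_intros)
    ultimately have "norm (G b - G 0) \<le> M / K * exp (K * b) - M / K * exp (K * 0)"
      using that by (intro differentiable_bound_general[where f' = g']) auto
    then show ?thesis
      using \<open>M \<ge> 0\<close> \<open>K > 0\<close> \<open>G 0 = 0\<close> by (auto intro: order_trans)
  qed
  consider "t = 0" | "t > 0" | "t < 0" by linarith
  then show ?thesis
  proof cases
    case 1
    then show ?thesis using \<open>M \<ge> 0\<close> \<open>K > 0\<close> \<open>F 0 = 0\<close> by simp
  next
    case 2
    have "norm (F t) \<le> M / K * exp (K * t)"
      using 2 \<open>F 0 = 0\<close> F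
    proof (rule forward)
      show "norm (g s) \<le> M * exp (K * s)" if "s > 0" for s
        using g[of s] that by simp
    qed
    then show ?thesis using 2 by simp
  next
    case 3
    have "norm (F (- (- t))) \<le> M / K * exp (K * (- t))"
    proof (rule forward)
      show "((\<lambda>t. F (- t)) has_vector_derivative - g (- s)) (at s)" for s
        using has_vector_derivative_reflect[of F "g (0 - s)" 0 s] F by simp
      show "norm (- g (- s)) \<le> M * exp (K * s)" if "s > 0" for s
        using g[of "- s"] that by simp
    qed (use 3 \<open>F 0 = 0\<close> in auto)
    then show ?thesis using 3 by simp
  qed
qed

text \<open>The Picard--Lindeloef theorem, by Banach's fixed point theorem for the bounded functions \<open>z\<close> with
  \<open>y t = exp (K * \<bar>t\<bar>) *\<^sub>R z t\<close>. With the weight the contraction works on the whole line at once, so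
  that no local solutions have to be continued.\<close>

theorem lipschitz_field_has_global_solution:
  fixes f :: "'a::euclidean_space \<Rightarrow> 'a"
  assumes lip: "L-lipschitz_on UNIV f"
  shows "\<exists>y. y 0 = y0 \<and> is_solution f y"
proof -
  define K where "K = 2 * (L + 1)"
  have "L \<ge> 0" using lip by (rule lipschitz_on_nonneg)
  then have "K > 0" by (simp add: K_def)
  define e where "e = (\<lambda>t. exp (K * \<bar>t\<bar>))"
  have e: "e t > 0" "e t \<ge> 1" "continuous_on S e" for t S
    using \<open>K > 0\<close> by (auto simp: e_def intro!: continuous_intros)
  have f_cont: "continuous_on UNIV f"
    using lip by (rule lipschitz_on_continuous_on)
  have f_lip: "norm (f x - f y) \<le> L * norm (x - y)" for x y
    using lipschitz_onD[OF lip, of x y] by (simp add: dist_norm)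
  have "\<exists>F. F 0 = 0 \<and> (\<forall>t. (F has_vector_derivative f (e t *\<^sub>R apply_bcontfun z t)) (at t))" for z
    by (intro antiderivative_on_line continuous_on_compose2[OF f_cont] continuous_intros e) auto
  then obtain I where I0: "\<And>z. I z 0 = 0"
    and I: "\<And>z t. (I z has_vector_derivative f (e t *\<^sub>R apply_bcontfun z t)) (at t)"
    by metis
  define P where "P = (\<lambda>z t. inverse (e t) *\<^sub>R (y0 + I z t))"
  have I_bound: "norm (I z t) \<le> (norm (f 0) + L * B) / K * e t"
    if B: "\<And>t. norm (apply_bcontfun z t) \<le> B" for z t B
    unfolding e_def using \<open>K > 0\<close> I0 I
  proof (rule exponential_growth_integrates)
    fix s
    have "norm (f (e s *\<^sub>R apply_bcontfun z s))
        \<le> norm (f 0) + norm (f (e s *\<^sub>R apply_bcontfun z s) - f 0)"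
      using norm_triangle_ineq[of "f 0" "f (e s *\<^sub>R apply_bcontfun z s) - f 0"] by simp
    also have "\<dots> \<le> norm (f 0) + L * (e s * norm (apply_bcontfun z s))"
      using f_lip[of "e s *\<^sub>R apply_bcontfun z s" 0] e(1)[of s] by simp
    also have "\<dots> \<le> norm (f 0) + L * (e s * B)"
      using e(1)[of s] B[of s] \<open>L \<ge> 0\<close> by (intro add_left_mono mult_left_mono) auto
    also have "\<dots> \<le> norm (f 0) * e s + L * (e s * B)"
      using mult_left_mono[OF e(2)[of s], of "norm (f 0)"] by simp
    finally show "norm (f (e s *\<^sub>R apply_bcontfun z s)) \<le> (norm (f 0) + L * B) * exp (K * \<bar>s\<bar>)"
      by (simp add: e_def algebra_simps)
  qed
  have P_bcontfun: "P z \<in> bcontfun" for z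
  proof -
    obtain B where B: "\<And>t. norm (apply_bcontfun z t) \<le> B"
      using bounded_apply_bcontfun[of z] by (auto simp: bounded_iff)
    have "continuous_on UNIV (I z)"
      by (rule continuous_on_vector_derivative) (rule has_vector_derivative_at_within, rule I)
    then have "continuous_on UNIV (P z)"
      unfolding P_def using e(3) less_imp_neq[OF e(1)] by (intro continuous_intros) auto
    moreover have "norm (P z t) \<le> norm y0 + (norm (f 0) + L * B) / K" for t
    proof -
      have "norm (P z t) = norm (y0 + I z t) / e t"
        using e(1)[of t] by (simp add: P_def divide_simps)
      also have "\<dots> \<le> (norm y0 * e t + (norm (f 0) + L * B) / K * e t) / e t"
      proof (intro divide_right_mono)
        have "norm y0 \<le> norm y0 * e t"
          using mult_left_mono[OF e(2)[of t], of "norm y0"] by simp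
        then show "norm (y0 + I z t) \<le> norm y0 * e t + (norm (f 0) + L * B) / K * e t"
          using I_bound[OF B, of t] norm_triangle_ineq[of y0 "I z t"] by linarith
      qed (use e(1)[of t] in simp)
      finally show ?thesis
        using e(1)[of t] by (simp add: add_divide_distrib)
    qed
    ultimately show ?thesis
      by (auto simp: bcontfun_def bounded_iff)
  qed
  have P_contraction: "dist (P z t) (P w t) \<le> 1/2 * dist z w" for z w t
  proof -
    have "norm (I z t - I w t) \<le> (L * dist z w) / K * e t"
      unfolding e_def using \<open>K > 0\<close>
    proof (rule exponential_growth_integrates)
      show "((\<lambda>t. I z t - I w t) has_vector_derivative
          f (e s *\<^sub>R apply_bcontfun z s) - f (e s *\<^sub>R apply_bcontfun w s)) (at s)" for s
        by (intro derivative_intros I)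
      fix s
      have "norm (f (e s *\<^sub>R apply_bcontfun z s) - f (e s *\<^sub>R apply_bcontfun w s))
          \<le> L * (e s * dist (apply_bcontfun z s) (apply_bcontfun w s))"
        using f_lip[of "e s *\<^sub>R apply_bcontfun z s" "e s *\<^sub>R apply_bcontfun w s"] e(1)[of s]
        by (simp add: dist_norm flip: scaleR_diff_right)
      also have "\<dots> \<le> L * (e s * dist z w)"
        using e(1)[of s] \<open>L \<ge> 0\<close> by (intro mult_left_mono dist_bounded) auto
      finally show "norm (f (e s *\<^sub>R apply_bcontfun z s) - f (e s *\<^sub>R apply_bcontfun w s))
          \<le> L * dist z w * exp (K * \<bar>s\<bar>)"
        by (simp add: e_def algebra_simps)
    qed (simp add: I0)
    moreover have "dist (P z t) (P w t) = norm (I z t - I w t) / e t"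
      using e(1)[of t]
      by (simp add: P_def dist_norm divide_simps flip: scaleR_diff_right)
    ultimately have "dist (P z t) (P w t) \<le> (L * dist z w) / K"
      using e(1)[of t] by (simp add: pos_divide_le_eq)
    also have "\<dots> \<le> 1/2 * dist z w"
      using \<open>L \<ge> 0\<close> by (simp add: K_def divide_simps algebra_simps)
    finally show ?thesis .
  qed
  have apply_P: "apply_bcontfun (Bcontfun (P z)) = P z" for z
    using P_bcontfun by (rule Bcontfun_inverse)
  have "\<exists>!z. Bcontfun (P z) = z"
  proof (rule banach_fix_type[of "1/2"], simp, simp, intro allI dist_bound)
    show "dist (apply_bcontfun (Bcontfun (P z)) t) (apply_bcontfun (Bcontfun (P w)) t)
        \<le> 1/2 * dist z w" for z w t
      unfolding apply_P by (rule P_contraction)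
  qed
  then obtain z where "P z = apply_bcontfun z"
    by (metis apply_P)
  then have "apply_bcontfun z t = inverse (e t) *\<^sub>R (y0 + I z t)" for t
    by (metis P_def)
  then have z: "e t *\<^sub>R apply_bcontfun z t = y0 + I z t" for t
    using e(1)[of t] by simp
  have "((\<lambda>t. y0 + I z t) has_vector_derivative f (y0 + I z t)) (at t)" for t
    using I[of z t] unfolding z by (auto intro!: derivative_eq_intros)
  then show ?thesis
    by (intro exI[of _ "\<lambda>t. y0 + I z t"]) (auto simp: is_solution_def I0)
qed

lemma is_solution_reverse_time:
  assumes "is_solution f y"
  shows "is_solution (\<lambda>x. - f x) (\<lambda>t. y (s - t))"
  unfolding is_solution_def
proof
  show "((\<lambda>t. y (s - t)) has_vector_derivative - f (y (s - t))) (at t)" for t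
    using assms by (intro has_vector_derivative_reflect) (simp add: is_solution_def)
qed

lemma is_solution_shift_time:
  assumes "is_solution f y"
  shows "is_solution f (\<lambda>t. y (s + t))"
  using is_solution_reverse_time[OF is_solution_reverse_time[OF assms, of s], of 0] by simp

lemma lipschitz_field_solution_unique:
  fixes f :: "'a::real_inner \<Rightarrow> 'a"
  assumes lip: "L-lipschitz_on UNIV f"
    and y: "is_solution f y" and z: "is_solution f z" and eq: "y 0 = z 0"
  shows "y = z"
proof -
  have forward: "y t = z t"
    if lip: "L-lipschitz_on UNIV f" and y: "is_solution f y" and z: "is_solution f z"
      and "y 0 = z 0" "t \<ge> 0" for f :: "'a \<Rightarrow> 'a" and y z t
  proof -
    define d where "d = (\<lambda>t. y t - z t)"
    define d' where "d' = (\<lambda>t. f (y t) - f (z t))"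
    have d: "(d has_derivative (\<lambda>h. h *\<^sub>R d' s)) (at s)" for s
      using y z unfolding is_solution_def d_def d'_def
      by (auto simp flip: has_vector_derivative_def intro!: derivative_intros)
    \<comment> \<open>Gronwall: the squared distance grows at most like \<open>exp (2 * L * t)\<close>.\<close>
    let ?E = "\<lambda>t. exp (- 2 * L * t) * (d t \<bullet> d t)"
    have "?E t \<le> ?E 0"
    proof (rule DERIV_nonpos_imp_nonincreasing[OF \<open>t \<ge> 0\<close>])
      fix s
      have "((\<lambda>t. d t \<bullet> d t) has_derivative (\<lambda>h. d s \<bullet> (h *\<^sub>R d' s) + (h *\<^sub>R d' s) \<bullet> d s)) (at s)"
        by (rule has_derivative_inner[OF d d])
      then have "((\<lambda>t. d t \<bullet> d t) has_real_derivative 2 * (d s \<bullet> d' s)) (at s)"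
        unfolding has_field_derivative_def
        by (rule has_derivative_eq_rhs) (auto simp: fun_eq_iff inner_commute)
      then have "(?E has_real_derivative exp (- 2 * L * s) * (2 * (d s \<bullet> d' s) - 2 * L * (d s \<bullet> d s))) (at s)"
        by (auto intro!: derivative_eq_intros simp: algebra_simps)
      moreover have "d s \<bullet> d' s \<le> L * (d s \<bullet> d s)"
      proof -
        have "d s \<bullet> d' s \<le> norm (d s) * norm (d' s)"
          by (rule norm_cauchy_schwarz)
        also have "\<dots> \<le> norm (d s) * (L * norm (d s))"
          using lipschitz_onD[OF lip, of "y s" "z s"]
          by (intro mult_left_mono) (auto simp: d_def d'_def dist_norm)
        finally show ?thesis
          by (simp add: dot_square_norm power2_eq_square algebra_simps)
      qed
      ultimately show "\<exists>D. (?E has_real_derivative D) (at s) \<and> D \<le> 0"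
        by (intro exI conjI) (assumption, simp add: mult_nonneg_nonpos)
    qed
    then have "d t \<bullet> d t \<le> 0"
      using \<open>y 0 = z 0\<close> by (simp add: d_def mult_le_0_iff not_le)
    then have "d t = 0"
      by (metis antisym inner_eq_zero_iff inner_ge_zero)
    then show ?thesis
      by (simp add: d_def)
  qed
  show ?thesis
  proof
    fix t :: real
    show "y t = z t"
    proof (cases "t \<ge> 0")
      case True
      then show ?thesis using forward[OF lip y z eq] by blast
    next
      case False
      have "y (0 - (- t)) = z (0 - (- t))"
        using False eq
        by (intro forward[of "\<lambda>x. - f x" "\<lambda>t. y (0 - t)" "\<lambda>t. z (0 - t)" "- t"]
            is_solution_reverse_time y z lipschitz_on_minus lip) auto
      then show ?thesis by simp
    qed
  qed
qed

section \<open>Centres of reversible fields\<close>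

text \<open>The components \<open>f\<close> and \<open>h\<close> are odd about \<open>\<phi> = c\<close>, so the field is reversible under the
  reflection \<open>\<phi> \<mapsto> 2 * c - \<phi>\<close>, and the plane \<open>\<phi> = c\<close> consists of equilibria and of points where
  the field is transverse to it. The last condition makes the motion near \<open>(c, 0, w)\<close> swing about
  the plane: the force pulls towards \<open>\<phi> = c\<close> at least as strongly as a spring of frequency \<open>\<omega>\<close>.\<close>

locale reversible_centre =
  fixes f h :: "real \<Rightarrow> real \<Rightarrow> real \<Rightarrow> real" and c w r L \<omega> :: real
  assumes r_pos: "r > 0" and \<omega>_pos: "\<omega> > 0"
    and f_odd: "f (2 * c - \<phi>) p q = - f \<phi> p q"
    and h_odd: "h (2 * c - \<phi>) p q = - h \<phi> p q"
    and lipschitz: "L-lipschitz_on ({c - r..c + r} \<times> {-r..r} \<times> {w - r..w + r})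
                      (\<lambda>(\<phi>, p, q). (p, f \<phi> p q, h \<phi> p q))"
    and restoring: "\<lbrakk>c \<le> \<phi>; \<phi> \<le> c + r; \<bar>p\<bar> \<le> r; \<bar>q - w\<bar> \<le> r\<rbrakk> \<Longrightarrow> f \<phi> p q \<le> - \<omega>\<^sup>2 * (\<phi> - c)"
begin

definition field :: "real \<times> real \<times> real \<Rightarrow> real \<times> real \<times> real" where
  "field = (\<lambda>(\<phi>, p, q). (p, f \<phi> p q, h \<phi> p q))"

definition clip :: "real \<Rightarrow> real \<Rightarrow> real" where
  "clip m s = max (m - r) (min (m + r) s)"

text \<open>A globally Lipschitz field which agrees with \<open>field\<close> on the box, so that its solutions exist for
  all times. Clipping respects the reflection, so this field is reversible, too.\<close>

definition truncated_field :: "real \<times> real \<times> real \<Rightarrow> real \<times> real \<times> real" where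
  "truncated_field = (\<lambda>(\<phi>, p, q). field (clip c \<phi>, clip 0 p, clip w q))"

lemma L_nonneg: "L \<ge> 0"
  using lipschitz by (rule lipschitz_on_nonneg)

lemma clip_id: "\<bar>s - m\<bar> \<le> r \<Longrightarrow> clip m s = s"
  by (auto simp: clip_def)

lemma clip_bound: "\<bar>clip m s - m\<bar> \<le> r"
  using r_pos by (auto simp: clip_def)

lemma clip_reflect: "clip c (2 * c - s) = 2 * c - clip c s"
  using r_pos by (auto simp: clip_def max_def min_def)

lemma clip_contraction: "\<bar>clip m s - clip m t\<bar> \<le> \<bar>s - t\<bar>"
  by (auto simp: clip_def max_def min_def)

lemma truncated_field_eq_field:
  "\<lbrakk>\<bar>\<phi> - c\<bar> \<le> r; \<bar>p\<bar> \<le> r; \<bar>q - w\<bar> \<le> r\<rbrakk> \<Longrightarrow> truncated_field (\<phi>, p, q) = field (\<phi>, p, q)"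
  by (simp add: truncated_field_def clip_id)

lemma lipschitz_truncated_field: "L-lipschitz_on UNIV truncated_field"
proof (rule lipschitz_onI)
  fix x y :: "real \<times> real \<times> real"
  obtain \<phi> p q where x: "x = (\<phi>, p, q)" by (cases x) auto
  obtain \<phi>' p' q' where y: "y = (\<phi>', p', q')" by (cases y) auto
  have box: "(clip c \<phi>, clip 0 p, clip w q) \<in> {c - r..c + r} \<times> {-r..r} \<times> {w - r..w + r}" for \<phi> p q
    using clip_bound[of c \<phi>] clip_bound[of 0 p] clip_bound[of w q] by (auto simp: abs_le_iff)
  have "dist (truncated_field x) (truncated_field y)
      \<le> L * dist (clip c \<phi>, clip 0 p, clip w q) (clip c \<phi>', clip 0 p', clip w q')"
    using lipschitz_onD[OF lipschitz box[of \<phi> p q] box[of \<phi>' p' q']]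
    by (simp add: truncated_field_def field_def x y)
  also have "dist (clip c \<phi>, clip 0 p, clip w q) (clip c \<phi>', clip 0 p', clip w q') \<le> dist x y"
    unfolding x y dist_Pair_Pair
    by (intro real_sqrt_le_mono add_mono power_mono) (auto simp: dist_real_def clip_contraction)
  finally show "dist (truncated_field x) (truncated_field y) \<le> L * dist x y"
    using L_nonneg by (simp add: mult_left_mono)
qed (rule L_nonneg)

text \<open>Both odd components vanish on the plane \<open>\<phi> = c\<close>, so the Lipschitz constant bounds them by the
  distance from this plane.\<close>

lemma odd_component_bounds:
  assumes "c \<le> \<phi>" "\<phi> \<le> c + r" "\<bar>p\<bar> \<le> r" "\<bar>q - w\<bar> \<le> r"
  shows "\<bar>f \<phi> p q\<bar> \<le> L * (\<phi> - c)" and "\<bar>h \<phi> p q\<bar> \<le> L * (\<phi> - c)"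
proof -
  have 0: "f c p q = 0" "h c p q = 0"
    using f_odd[of c p q] h_odd[of c p q] by auto
  have "dist (p, f \<phi> p q, h \<phi> p q) (p, f c p q, h c p q) \<le> L * dist (\<phi>, p, q) (c, p, q)"
    using lipschitz_onD[OF lipschitz, of "(\<phi>, p, q)" "(c, p, q)"] assms r_pos
    by (auto simp: abs_le_iff)
  then have *: "norm (f \<phi> p q, h \<phi> p q) \<le> L * (\<phi> - c)"
    using assms by (simp add: dist_Pair_Pair dist_real_def 0 norm_Pair)
  show "\<bar>f \<phi> p q\<bar> \<le> L * (\<phi> - c)" "\<bar>h \<phi> p q\<bar> \<le> L * (\<phi> - c)"
    using order_trans[OF norm_fst_le *] order_trans[OF norm_snd_le *] by auto
qed

definition reflect :: "real \<times> real \<times> real \<Rightarrow> real \<times> real \<times> real" where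
  "reflect = (\<lambda>(\<phi>, p, q). (2 * c - \<phi>, p, q))"

text \<open>The curve \<open>t \<mapsto> reflect (y (s - t))\<close> is again a solution and agrees with \<open>t \<mapsto> y (s + t)\<close> at
  \<open>t = 0\<close>.\<close>

lemma solution_symmetric:
  assumes y: "is_solution truncated_field y" and "fst (y s) = c"
  shows "y (s + t) = reflect (y (s - t))"
proof -
  have "is_solution truncated_field (\<lambda>t. reflect (y (s - t)))"
    unfolding is_solution_def
  proof
    fix t
    define A :: "real \<times> real \<times> real \<Rightarrow> real \<times> real \<times> real" where "A = (\<lambda>(\<phi>, p, q). (- \<phi>, p, q))"
    have A: "bounded_linear A"
      unfolding A_def by (auto simp flip: linear_conv_bounded_linear intro!: linearI)
    have reflect: "reflect z = (2 * c, 0, 0) + A z" for z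
      by (simp add: reflect_def A_def split_beta zero_prod_def)
    have "((\<lambda>t. y (s - t)) has_vector_derivative - truncated_field (y (s - t))) (at t)"
      using is_solution_reverse_time[OF y] by (simp add: is_solution_def)
    then have "((\<lambda>t. reflect (y (s - t))) has_vector_derivative A (- truncated_field (y (s - t)))) (at t)"
      unfolding reflect
      using has_vector_derivative_add[OF has_vector_derivative_const[of "(2 * c, 0, 0)"]
          bounded_linear.has_vector_derivative[OF A]] by simp
    moreover have "A (- truncated_field z) = truncated_field (reflect z)" for z
      by (auto simp: A_def reflect_def truncated_field_def field_def clip_reflect f_odd h_odd
          split_beta)
    ultimately show "((\<lambda>t. reflect (y (s - t))) has_vector_derivative
        truncated_field (reflect (y (s - t)))) (at t)"
      by simp
  qed
  moreover have "y (s + 0) = reflect (y (s - 0))"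
    using assms(2) by (simp add: reflect_def split_beta prod_eq_iff)
  ultimately have "(\<lambda>t. y (s + t)) = (\<lambda>t. reflect (y (s - t)))"
    using lipschitz_field_solution_unique[OF lipschitz_truncated_field]
      is_solution_shift_time[OF y, of s] by blast
  then show ?thesis by (rule fun_cong)
qed

end

text \<open>An orbit that leaves the plane \<open>\<phi> = c\<close> with small speed \<open>a\<close>. The bounds on \<open>a\<close> keep it in the
  box for the time \<open>pi / \<omega>\<close>, by which it has returned to the plane.\<close>

locale launched_orbit = reversible_centre +
  fixes a v :: real and y :: "real \<Rightarrow> real \<times> real \<times> real"
  assumes a_pos: "a > 0" and a_le: "a \<le> r" and a_\<phi>: "a * (pi / \<omega>) \<le> r"
    and a_pq: "L * a * (pi / \<omega>)\<^sup>2 \<le> r / 2"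
    and v: "\<bar>v - w\<bar> \<le> r / 2"
    and y0: "y 0 = (c, a, v)" and y: "is_solution truncated_field y"
begin

definition "\<phi> t = fst (y t)"
definition "p t = fst (snd (y t))"
definition "q t = snd (snd (y t))"

lemma y_eq: "y t = (\<phi> t, p t, q t)"
  by (simp add: \<phi>_def p_def q_def)

lemma initial: "\<phi> 0 = c" "p 0 = a" "q 0 = v"
  by (simp_all add: \<phi>_def p_def q_def y0)

lemma derivatives:
  "(\<phi> has_real_derivative clip 0 (p t)) (at t)"
  "(p has_real_derivative f (clip c (\<phi> t)) (clip 0 (p t)) (clip w (q t))) (at t)"
  "(q has_real_derivative h (clip c (\<phi> t)) (clip 0 (p t)) (clip w (q t))) (at t)"
proof -
  have y': "(y has_vector_derivative truncated_field (y t)) (at t)"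
    using y by (simp add: is_solution_def)
  have tf: "truncated_field (y t) = (clip 0 (p t), f (clip c (\<phi> t)) (clip 0 (p t)) (clip w (q t)),
      h (clip c (\<phi> t)) (clip 0 (p t)) (clip w (q t)))"
    by (simp add: y_eq truncated_field_def field_def)
  show "(\<phi> has_real_derivative clip 0 (p t)) (at t)"
    using bounded_linear.has_vector_derivative[OF bounded_linear_fst y']
    by (simp add: tf \<phi>_def[abs_def] has_real_derivative_iff_has_vector_derivative)
  show "(p has_real_derivative f (clip c (\<phi> t)) (clip 0 (p t)) (clip w (q t))) (at t)"
    using bounded_linear.has_vector_derivative[OF bounded_linear_fst
        bounded_linear.has_vector_derivative[OF bounded_linear_snd y']]
    by (simp add: tf p_def[abs_def] has_real_derivative_iff_has_vector_derivative)
  show "(q has_real_derivative h (clip c (\<phi> t)) (clip 0 (p t)) (clip w (q t))) (at t)"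
    using bounded_linear.has_vector_derivative[OF bounded_linear_snd
        bounded_linear.has_vector_derivative[OF bounded_linear_snd y']]
    by (simp add: tf q_def[abs_def] has_real_derivative_iff_has_vector_derivative)
qed

lemma \<phi>_continuous: "continuous_on S \<phi>"
  using derivatives(1) by (meson DERIV_isCont continuous_at_imp_continuous_on)

text \<open>The bounds come one from another: on the right of the plane the force is directed to it, so
  \<open>p \<le> a\<close>; hence \<open>\<phi> - c \<le> a * pi / \<omega>\<close>; hence both accelerations are at most \<open>L * a * pi / \<omega>\<close>.\<close>

lemma stays_in_box:
  assumes T: "T \<le> pi / \<omega>" and right: "\<And>t. 0 \<le> t \<Longrightarrow> t \<le> T \<Longrightarrow> c \<le> \<phi> t"
    and t: "0 \<le> t" "t \<le> T"
  shows "\<phi> t \<le> c + r" "\<bar>p t\<bar> \<le> r" "\<bar>q t - w\<bar> \<le> r"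
proof -
  have p_le: "p s \<le> a" if s: "0 \<le> s" "s \<le> T" for s
  proof -
    have "p s \<le> p 0"
    proof (rule DERIV_nonpos_imp_nonincreasing[OF s(1)])
      fix u assume u: "0 \<le> u" "u \<le> s"
      have "c \<le> clip c (\<phi> u)"
        using right[of u] u s r_pos by (simp add: clip_def)
      then have "f (clip c (\<phi> u)) (clip 0 (p u)) (clip w (q u)) \<le> - \<omega>\<^sup>2 * (clip c (\<phi> u) - c)"
        using clip_bound[of c "\<phi> u"] clip_bound[of 0 "p u"] clip_bound[of w "q u"]
        by (intro restoring) auto
      also have "\<dots> \<le> 0"
        using \<open>c \<le> clip c (\<phi> u)\<close> by simp
      finally show "\<exists>D. (p has_real_derivative D) (at u) \<and> D \<le> 0"
        using derivatives(2) by blast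
    qed
    then show ?thesis by (simp add: initial)
  qed
  have \<phi>_le: "\<phi> s - c \<le> a * (pi / \<omega>)" if s: "0 \<le> s" "s \<le> T" for s
  proof -
    have "\<phi> s - a * s \<le> \<phi> 0 - a * 0"
    proof (rule DERIV_nonpos_imp_nonincreasing[OF s(1)])
      fix u assume u: "0 \<le> u" "u \<le> s"
      have "clip 0 (p u) \<le> a"
        using p_le[of u] u s r_pos a_pos by (simp add: clip_def)
      then show "\<exists>D. ((\<lambda>s. \<phi> s - a * s) has_real_derivative D) (at u) \<and> D \<le> 0"
        by (intro exI[of _ "clip 0 (p u) - a"]) (auto intro!: derivative_eq_intros derivatives)
    qed
    then have "\<phi> s - c \<le> a * s" by (simp add: initial)
    also have "\<dots> \<le> a * (pi / \<omega>)"
      using s T a_pos by (intro mult_left_mono) auto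
    finally show ?thesis .
  qed
  show "\<phi> t \<le> c + r"
    using \<phi>_le[OF t] a_\<phi> by simp
  have slow: "\<bar>g t - g 0\<bar> \<le> r / 2"
    if g: "\<And>s. (g has_real_derivative k (clip c (\<phi> s)) (clip 0 (p s)) (clip w (q s))) (at s)"
      and k: "\<And>\<phi> p q. \<lbrakk>c \<le> \<phi>; \<phi> \<le> c + r; \<bar>p\<bar> \<le> r; \<bar>q - w\<bar> \<le> r\<rbrakk> \<Longrightarrow> \<bar>k \<phi> p q\<bar> \<le> L * (\<phi> - c)"
    for g :: "real \<Rightarrow> real" and k
  proof -
    have "\<bar>k (clip c (\<phi> s)) (clip 0 (p s)) (clip w (q s))\<bar> \<le> L * (a * (pi / \<omega>))"
      if s: "0 \<le> s" "s \<le> T" for s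
    proof -
      have "clip c (\<phi> s) = \<phi> s"
        using right[OF s] \<phi>_le[OF s] a_\<phi> by (intro clip_id) simp
      then have "\<bar>k (clip c (\<phi> s)) (clip 0 (p s)) (clip w (q s))\<bar> \<le> L * (\<phi> s - c)"
        using right[OF s] \<phi>_le[OF s] a_\<phi> clip_bound[of 0 "p s"] clip_bound[of w "q s"]
        by (simp add: k)
      also have "\<dots> \<le> L * (a * (pi / \<omega>))"
        using \<phi>_le[OF s] L_nonneg by (rule mult_left_mono)
      finally show ?thesis .
    qed
    then have "norm (g t - g 0) \<le> L * (a * (pi / \<omega>)) * norm (t - 0)"
      using t by (intro field_differentiable_bound[where S = "{0..t}",
            OF _ has_field_derivative_at_within[OF g]]) auto
    also have "\<dots> \<le> L * (a * (pi / \<omega>)) * (pi / \<omega>)"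
      using t T L_nonneg a_pos \<omega>_pos by (intro mult_left_mono) auto
    also have "\<dots> \<le> r / 2"
      using a_pq by (simp add: power2_eq_square algebra_simps)
    finally show ?thesis by simp
  qed
  have "\<bar>p t - a\<bar> \<le> r / 2"
    using slow[OF derivatives(2) odd_component_bounds(1)] by (simp add: initial)
  then show "\<bar>p t\<bar> \<le> r"
    using p_le[OF t] a_pos a_le by linarith
  have "\<bar>q t - v\<bar> \<le> r / 2"
    using slow[OF derivatives(3) odd_component_bounds(2)] by (simp add: initial)
  then show "\<bar>q t - w\<bar> \<le> r"
    using v by linarith
qed

text \<open>Sturm comparison with the harmonic oscillator of frequency \<open>\<omega>\<close>: as long as \<open>\<phi> \<ge> c\<close>, the Wronskian
  of \<open>\<phi> - c\<close> and \<open>sin (\<omega> * t)\<close> cannot increase. It starts at 0, and its value at \<open>pi / \<omega>\<close> is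
  \<open>\<omega> * (\<phi> - c)\<close>.\<close>

lemma returns_within_half_period:
  "\<exists>t. 0 < t \<and> t \<le> pi / \<omega> \<and> \<phi> t \<le> c"
proof (rule ccontr)
  assume "\<not> ?thesis"
  then have pos: "c < \<phi> t" if "0 < t" "t \<le> pi / \<omega>" for t
    using that by force
  then have right: "c \<le> \<phi> t" if "0 \<le> t" "t \<le> pi / \<omega>" for t
    using that initial(1) by (cases "t = 0") (auto intro: less_imp_le)
  let ?W = "\<lambda>t. p t * sin (\<omega> * t) - \<omega> * ((\<phi> t - c) * cos (\<omega> * t))"
  have "?W (pi / \<omega>) \<le> ?W 0"
  proof (rule DERIV_nonpos_imp_nonincreasing[where f = ?W])
    fix t assume t: "0 \<le> t" "t \<le> pi / \<omega>"
    note box = stays_in_box[OF order_refl right t]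
    have cuts: "clip c (\<phi> t) = \<phi> t" "clip 0 (p t) = p t" "clip w (q t) = q t"
      using box right[OF t] by (auto intro!: clip_id)
    have "(?W has_real_derivative (f (\<phi> t) (p t) (q t) + \<omega>\<^sup>2 * (\<phi> t - c)) * sin (\<omega> * t)) (at t)"
      using derivatives[of t] unfolding cuts
      by (auto intro!: derivative_eq_intros simp: power2_eq_square algebra_simps)
    moreover have "(f (\<phi> t) (p t) (q t) + \<omega>\<^sup>2 * (\<phi> t - c)) * sin (\<omega> * t) \<le> 0"
    proof (rule mult_nonpos_nonneg)
      show "f (\<phi> t) (p t) (q t) + \<omega>\<^sup>2 * (\<phi> t - c) \<le> 0"
        using restoring[OF right[OF t] box] by simp
      show "0 \<le> sin (\<omega> * t)"
        using t \<omega>_pos by (intro sin_ge_zero) (auto simp: field_simps)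
    qed
    ultimately show "\<exists>D. (?W has_real_derivative D) (at t) \<and> D \<le> 0" by blast
  qed (use \<omega>_pos in simp)
  then have "\<omega> * (\<phi> (pi / \<omega>) - c) \<le> 0"
    using \<omega>_pos by (simp add: initial algebra_simps)
  moreover have "c < \<phi> (pi / \<omega>)"
    using \<omega>_pos by (intro pos) auto
  ultimately show False
    using \<omega>_pos by (simp add: mult_le_0_iff)
qed

lemma first_return:
  obtains T where "0 < T" "T \<le> pi / \<omega>" "\<phi> T = c" "\<And>t. 0 < t \<Longrightarrow> t < T \<Longrightarrow> c < \<phi> t"
proof -
  have "clip 0 (p 0) > 0"
    using a_pos r_pos by (simp add: initial clip_def)
  then obtain d where d: "d > 0" "\<And>t. 0 < t \<Longrightarrow> t < d \<Longrightarrow> c < \<phi> t"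
    using DERIV_pos_inc_right[OF derivatives(1)[of 0]] by (auto simp: initial)
  define S where "S = {t \<in> {d / 2..pi / \<omega>}. \<phi> t \<le> c}"
  obtain t1 where t1: "0 < t1" "t1 \<le> pi / \<omega>" "\<phi> t1 \<le> c"
    using returns_within_half_period by blast
  then have "t1 \<in> S"
    using d(2)[of t1] d(1) by (force simp: S_def)
  moreover have "compact S"
  proof -
    have "S = {d / 2..pi / \<omega>} \<inter> {t. \<phi> t \<le> c}" by (auto simp: S_def)
    then show ?thesis
      by (simp add: compact_Int_closed closed_Collect_le \<phi>_continuous)
  qed
  ultimately obtain T where T: "T \<in> S" "\<And>t. t \<in> S \<Longrightarrow> T \<le> t"
    using compact_attains_inf[of S] by blast
  have before: "c < \<phi> t" if "0 < t" "t < T" for t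
  proof (cases "t < d")
    case False
    then show ?thesis
      using T(1) T(2)[of t] that d(1) by (force simp: S_def)
  qed (use that d in auto)
  have "\<phi> T = c"
  proof (rule ccontr)
    assume "\<phi> T \<noteq> c"
    then have "\<phi> T < c" using T(1) by (simp add: S_def)
    moreover have "c < \<phi> (d / 2)" using d by simp
    ultimately obtain t where "d / 2 \<le> t" "t \<le> T" "\<phi> t = c"
      using IVT2'[of \<phi> T c "d / 2"] \<phi>_continuous T(1) by (auto simp: S_def)
    then show False
      using before[of t] d(1) \<open>\<phi> T < c\<close> by (cases "t = T") auto
  qed
  then show thesis
    using that[of T] T(1) d(1) before by (auto simp: S_def)
qed

text \<open>The orbit from launch to first return and its mirror image close up to a periodic orbit. The
  return happens with \<open>p \<le> 0\<close>, so each period crosses \<open>\<phi> = c\<close> only once with \<open>p > 0\<close>.\<close>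

theorem closes_up:
  "is_solution field y" "periodic_curve y" "\<not> y constant_on UNIV"
  "\<And>t. \<lbrakk>\<phi> t = c; p t > 0\<rbrakk> \<Longrightarrow> y t = (c, a, v)"
proof -
  obtain T where T: "0 < T" "T \<le> pi / \<omega>" "\<phi> T = c"
    and T_first: "\<And>t. 0 < t \<Longrightarrow> t < T \<Longrightarrow> c < \<phi> t"
    by (rule first_return) blast
  have symm0: "y t = reflect (y (- t))" for t
    using solution_symmetric[OF y, of 0 t] initial(1) by (simp add: \<phi>_def)
  have "y (t + 2 * T) = y t" for t
    using solution_symmetric[OF y, of T "t + T"] symm0[of t] T(3) by (simp add: \<phi>_def algebra_simps)
  then interpret periodic_fun_simple y "2 * T"
    by unfold_locales
  show "periodic_curve y"
    using plus_1 T(1) unfolding periodic_curve_def by (intro exI[of _ "2 * T"]) simp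
  have fundamental: "\<exists>s. - T \<le> s \<and> s < T \<and> y t = y s" for t
  proof -
    define n where "n = \<lfloor>(t + T) / (2 * T)\<rfloor>"
    have "of_int n \<le> (t + T) / (2 * T)" "(t + T) / (2 * T) < of_int n + 1"
      unfolding n_def by linarith+
    then have "of_int n * (2 * T) \<le> t + T" "t + T < (of_int n + 1) * (2 * T)"
      using T(1) by (simp_all add: pos_le_divide_eq pos_divide_less_eq)
    then show ?thesis
      by (intro exI[of _ "t - of_int n * (2 * T)"]) (simp add: minus_of_int, simp add: algebra_simps)
  qed
  have right: "c \<le> \<phi> t" if "0 \<le> t" "t \<le> T" for t
    using that T_first[of t] T(3) initial(1) by (cases "t = 0 \<or> t = T") (auto intro: less_imp_le)
  have mirror: "\<phi> t = 2 * c - \<phi> (- t)" "p t = p (- t)" "q t = q (- t)" for t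
    using symm0[of t] by (auto simp: \<phi>_def p_def q_def reflect_def split_beta)
  have box: "\<bar>\<phi> t - c\<bar> \<le> r \<and> \<bar>p t\<bar> \<le> r \<and> \<bar>q t - w\<bar> \<le> r" for t
  proof -
    have arc: "\<bar>\<phi> s - c\<bar> \<le> r \<and> \<bar>p s\<bar> \<le> r \<and> \<bar>q s - w\<bar> \<le> r" if "0 \<le> s" "s \<le> T" for s
      using stays_in_box[OF T(2) right that] right[OF that] by auto
    obtain s where s: "- T \<le> s" "s < T" "y t = y s"
      using fundamental by blast
    have "\<bar>\<phi> s - c\<bar> \<le> r \<and> \<bar>p s\<bar> \<le> r \<and> \<bar>q s - w\<bar> \<le> r"
    proof (cases "0 \<le> s")
      case True
      then show ?thesis using arc s by simp
    next
      case False
      then show ?thesis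
        using arc[of "- s"] s mirror[of s] by (auto simp: abs_le_iff)
    qed
    then show ?thesis
      using s(3) by (simp add: \<phi>_def p_def q_def)
  qed
  show "is_solution field y"
    using y truncated_field_eq_field box unfolding is_solution_def by (metis y_eq)
  show "\<not> y constant_on UNIV"
  proof
    assume "y constant_on UNIV"
    then have "\<phi> (T / 2) = \<phi> 0"
      unfolding constant_on_def \<phi>_def by (metis UNIV_I)
    then show False
      using T_first[of "T / 2"] T(1) initial(1) by simp
  qed
  have "p T \<le> 0"
  proof (rule ccontr)
    assume "\<not> p T \<le> 0"
    then have "clip 0 (p T) > 0"
      using r_pos by (simp add: clip_def)
    then obtain d where d: "d > 0" "\<And>s. 0 < s \<Longrightarrow> s < d \<Longrightarrow> \<phi> (T - s) < c"
      using DERIV_pos_inc_left[OF derivatives(1)[of T]] T(3) by auto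
    define s where "s = min d T / 2"
    have "0 < s" "s < d" "s < T"
      using d(1) T(1) by (auto simp: s_def min_def)
    then show False
      using d(2)[of s] T_first[of "T - s"] by simp
  qed
  show "y t = (c, a, v)" if t: "\<phi> t = c" "p t > 0" for t
  proof -
    obtain s where s: "- T \<le> s" "s < T" "y t = y s"
      using fundamental by blast
    then have s': "\<phi> s = c" "p s > 0"
      using t by (simp_all add: \<phi>_def p_def)
    then have "s \<noteq> - T"
      using \<open>p T \<le> 0\<close> mirror(2)[of T] by auto
    moreover have "\<not> 0 < s"
      using T_first[of s] s s' by auto
    moreover have "\<not> s < 0"
      using T_first[of "- s"] s s' mirror(1)[of s] \<open>s \<noteq> - T\<close> by auto
    ultimately have "s = 0" using s by simp
    then show ?thesis using s(3) y0 by simp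
  qed
qed

end

section \<open>The two-parameter family\<close>

lemma Ck_on_const: "Ck_on k U (\<lambda>x. b)"
  by (induction k arbitrary: b) auto

lemma frechet_derivative_affine:
  assumes "bounded_linear g"
  shows "frechet_derivative (\<lambda>x. b + g x) (at x) = g"
proof -
  have "((\<lambda>x. b + g x) has_derivative (\<lambda>x. 0 + g x)) (at x)"
    by (intro has_derivative_add has_derivative_const bounded_linear_imp_has_derivative assms)
  then show ?thesis
    by (simp add: frechet_derivative_at[symmetric])
qed

lemma differentiable_affine:
  "bounded_linear g \<Longrightarrow> (\<lambda>x. b + g x) differentiable (at x)"
  by (intro differentiable_add differentiable_const bounded_linear_imp_differentiable)

lemma smooth_map_on_affine:
  assumes "bounded_linear g"
  shows "smooth_map_on U (\<lambda>x. b + g x)"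
  unfolding smooth_map_on_def
proof
  fix k
  have "continuous_on U (\<lambda>x. b + g x)"
    by (intro continuous_intros linear_continuous_on assms)
  then show "Ck_on k U (\<lambda>x. b + g x)"
    using assms
    by (cases k) (auto simp: frechet_derivative_affine differentiable_affine Ck_on_const)
qed

context reversible_centre
begin

text \<open>The family is launched from a rectangle in the plane \<open>\<phi> = c\<close>, with coordinates \<open>(a, v)\<close>. Its
  members are distinct as sets because an orbit meets the half \<open>p > 0\<close> of the plane in its launch
  point only.\<close>

theorem two_parameter_family: "has_two_parameter_family_of_periodic_solutions field"
proof -
  define \<tau> where "\<tau> = pi / \<omega>"
  have \<tau>: "\<tau> > 0" using \<omega>_pos by (simp add: \<tau>_def)
  \<comment> \<open>The smallness conditions on the launch speed in \<open>launched_orbit\<close>; adding 1 to \<open>L * \<tau>\<^sup>2\<close>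
    avoids a division by zero.\<close>
  define a0 where "a0 = min r (min (r / \<tau>) (r / (2 * (L * \<tau>\<^sup>2 + 1))))"
  have D_pos: "2 * (L * \<tau>\<^sup>2 + 1) > 0"
    using L_nonneg by (simp add: add_nonneg_pos)
  then have "a0 > 0"
    using r_pos \<tau> by (simp add: a0_def)
  define U where "U = {0<..<a0} \<times> {w - r / 2<..<w + r / 2}"
  define \<sigma> where "\<sigma> = (\<lambda>u :: real \<times> real. (c, 0, 0) + (0, u))"
  have \<sigma>: "\<sigma> u = (c, u)" for u
    by (simp add: \<sigma>_def flip: zero_prod_def)
  have linear: "bounded_linear (\<lambda>u :: real \<times> real. (0 :: real, u))"
    by (intro bounded_linear_Pair bounded_linear_zero bounded_linear_ident)
  have \<sigma>': "frechet_derivative \<sigma> (at u) = (\<lambda>u. (0, u))" for u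
    unfolding \<sigma>_def by (rule frechet_derivative_affine[OF linear])
  have "\<exists>y. y 0 = \<sigma> u \<and> is_solution field y \<and> periodic_curve y \<and> \<not> y constant_on UNIV \<and>
      (\<forall>t. fst (y t) = c \<and> fst (snd (y t)) > 0 \<longrightarrow> y t = \<sigma> u)" if u: "u \<in> U" for u
  proof -
    obtain a v where av: "u = (a, v)" by fastforce
    obtain y where y: "y 0 = (c, a, v)" "is_solution truncated_field y"
      using lipschitz_field_has_global_solution[OF lipschitz_truncated_field] by blast
    have a: "0 < a" "a \<le> r" "a \<le> r / \<tau>" "a \<le> r / (2 * (L * \<tau>\<^sup>2 + 1))"
      using u by (auto simp: av U_def a0_def)
    have "2 * (a * (L * \<tau>\<^sup>2 + 1)) \<le> r"
      using a(4) D_pos by (simp add: pos_le_divide_eq algebra_simps)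
    then have "L * a * \<tau>\<^sup>2 \<le> r / 2"
      using a(1) by (simp add: algebra_simps)
    moreover have "\<bar>v - w\<bar> \<le> r / 2"
    proof -
      have "w - r / 2 < v" "v < w + r / 2"
        using u by (simp_all add: av U_def)
      then show ?thesis by linarith
    qed
    ultimately interpret launched_orbit f h c w r L \<omega> a v y
      using a u y \<tau>
      by unfold_locales (auto simp: av U_def pos_le_divide_eq abs_le_iff simp flip: \<tau>_def)
    show ?thesis
      using closes_up y0 unfolding \<phi>_def p_def by (intro exI[of _ y]) (auto simp: \<sigma> av)
  qed
  then have "\<forall>u\<in>U. \<exists>y. y 0 = \<sigma> u \<and> is_solution field y \<and> periodic_curve y \<and> \<not> y constant_on UNIV \<and>
      (\<forall>t. fst (y t) = c \<and> fst (snd (y t)) > 0 \<longrightarrow> y t = \<sigma> u)"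
    by blast
  from bchoice[OF this] obtain \<gamma> where \<gamma>: "\<And>u. u \<in> U \<Longrightarrow> \<gamma> u 0 = \<sigma> u"
    "\<And>u. u \<in> U \<Longrightarrow> is_solution field (\<gamma> u)" "\<And>u. u \<in> U \<Longrightarrow> periodic_curve (\<gamma> u)"
    "\<And>u. u \<in> U \<Longrightarrow> \<not> \<gamma> u constant_on UNIV"
    "\<And>u t. u \<in> U \<Longrightarrow> fst (\<gamma> u t) = c \<Longrightarrow> fst (snd (\<gamma> u t)) > 0 \<Longrightarrow> \<gamma> u t = \<sigma> u"
    by blast
  have "inj_on (\<lambda>u. range (\<gamma> u)) U"
  proof (rule inj_onI)
    fix u u' assume u: "u \<in> U" "u' \<in> U" and "range (\<gamma> u) = range (\<gamma> u')"
    then obtain t where t: "\<gamma> u t = \<sigma> u'"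
      using \<gamma>(1)[OF u(2)] by (metis rangeE rangeI)
    moreover have "fst u' > 0"
      using u(2) by (auto simp: U_def)
    ultimately have "\<gamma> u t = \<sigma> u"
      using u by (intro \<gamma>(5)) (auto simp: \<sigma>)
    then show "u = u'"
      using t by (simp add: \<sigma>)
  qed
  moreover have "transverse_on U \<sigma> field"
    unfolding transverse_on_def \<sigma>'
  proof
    fix u assume "u \<in> U"
    then have a: "fst u > 0" by (auto simp: U_def)
    let ?S = "insert (field (\<sigma> u)) (range (\<lambda>u :: real \<times> real. (0, u)))"
    have "z \<in> span ?S" for z
    proof -
      define k where "k = fst z / fst u"
      have "fst z = k * fst (field (\<sigma> u))"
        using a by (simp add: k_def \<sigma> field_def split_beta)
      then have "z = k *\<^sub>R field (\<sigma> u) + (0, snd z - k *\<^sub>R snd (field (\<sigma> u)))"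
        by (simp add: prod_eq_iff)
      moreover have "k *\<^sub>R field (\<sigma> u) \<in> span ?S"
        by (intro span_scale span_base) simp
      moreover have "(0, snd z - k *\<^sub>R snd (field (\<sigma> u))) \<in> span ?S"
        by (intro span_base) simp
      ultimately show ?thesis
        by (metis span_add)
    qed
    then show "span ?S = UNIV" by blast
  qed
  moreover have "open U" "U \<noteq> {}"
    using \<open>a0 > 0\<close> r_pos by (auto simp: U_def open_Times)
  moreover have "smooth_map_on U \<sigma>"
    unfolding \<sigma>_def by (rule smooth_map_on_affine[OF linear])
  moreover have "inj_on \<sigma> U"
    by (auto simp: \<sigma> inj_on_def)
  moreover have "immersion_on U \<sigma>"
    unfolding immersion_on_def \<sigma>'
    using differentiable_affine[OF linear] by (auto simp: \<sigma>_def inj_on_def)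
  ultimately show ?thesis
    unfolding has_two_parameter_family_of_periodic_solutions_def
    using \<gamma> by (intro exI[of _ U] exI[of _ \<sigma>] exI[of _ \<gamma>]) blast
qed

end

section \<open>Products and quotients of bounded Lipschitz functions\<close>

text \<open>Boundedness is included because a product of Lipschitz functions need not be Lipschitz
  without it.\<close>

definition bounded_lipschitz :: "'a::metric_space set \<Rightarrow> ('a \<Rightarrow> real) \<Rightarrow> bool" where
  "bounded_lipschitz S f \<longleftrightarrow> (\<exists>B. \<forall>x\<in>S. \<bar>f x\<bar> \<le> B) \<and> (\<exists>L. L-lipschitz_on S f)"

lemma bounded_lipschitz_const: "bounded_lipschitz S (\<lambda>x. k)"
  unfolding bounded_lipschitz_def by (auto intro: lipschitz_on_constant)

lemma bounded_lipschitz_add: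
  assumes "bounded_lipschitz S f" "bounded_lipschitz S g"
  shows "bounded_lipschitz S (\<lambda>x. f x + g x)"
proof -
  obtain B B' L L' where *: "\<And>x. x \<in> S \<Longrightarrow> \<bar>f x\<bar> \<le> B" "\<And>x. x \<in> S \<Longrightarrow> \<bar>g x\<bar> \<le> B'"
    "L-lipschitz_on S f" "L'-lipschitz_on S g"
    using assms unfolding bounded_lipschitz_def by blast
  have "\<bar>f x + g x\<bar> \<le> B + B'" if "x \<in> S" for x
    using *(1,2)[OF that] by linarith
  moreover have "(L + L')-lipschitz_on S (\<lambda>x. f x + g x)"
    using * by (intro lipschitz_intros)
  ultimately show ?thesis
    unfolding bounded_lipschitz_def by blast
qed

lemma bounded_lipschitz_mult:
  assumes "bounded_lipschitz S f" "bounded_lipschitz S g"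
  shows "bounded_lipschitz S (\<lambda>x. f x * g x)"
proof (cases "S = {}")
  case False
  obtain B B' L L' where *: "\<And>x. x \<in> S \<Longrightarrow> \<bar>f x\<bar> \<le> B" "\<And>x. x \<in> S \<Longrightarrow> \<bar>g x\<bar> \<le> B'"
    "L-lipschitz_on S f" "L'-lipschitz_on S g"
    using assms unfolding bounded_lipschitz_def by blast
  have nonneg: "0 \<le> B" "0 \<le> B'" "0 \<le> L" "0 \<le> L'"
    using False *(1,2) order_trans[OF abs_ge_zero] lipschitz_on_nonneg[OF *(3)]
      lipschitz_on_nonneg[OF *(4)] by blast+
  have "\<bar>f x * g x\<bar> \<le> B * B'" if "x \<in> S" for x
    using *(1,2)[OF that] nonneg unfolding abs_mult by (intro mult_mono) auto
  moreover have "(B * L' + L * B')-lipschitz_on S (\<lambda>x. f x * g x)"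
  proof (rule lipschitz_onI)
    fix x y assume xy: "x \<in> S" "y \<in> S"
    have "\<bar>f x * g x - f y * g y\<bar> = \<bar>f x * (g x - g y) + (f x - f y) * g y\<bar>"
      by (simp add: algebra_simps)
    also have "\<dots> \<le> \<bar>f x\<bar> * \<bar>g x - g y\<bar> + \<bar>f x - f y\<bar> * \<bar>g y\<bar>"
      unfolding abs_mult[symmetric] by (rule abs_triangle_ineq)
    also have "\<dots> \<le> B * (L' * dist x y) + (L * dist x y) * B'"
      using *(1)[OF xy(1)] *(2)[OF xy(2)] nonneg
        lipschitz_onD[OF *(3) xy] lipschitz_onD[OF *(4) xy]
      by (intro add_mono mult_mono) (auto simp: dist_real_def)
    finally show "dist (f x * g x) (f y * g y) \<le> (B * L' + L * B') * dist x y"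
      by (simp add: dist_real_def algebra_simps)
  qed (use nonneg in simp)
  ultimately show ?thesis
    unfolding bounded_lipschitz_def by blast
qed (auto simp: bounded_lipschitz_def intro!: exI[of _ 0])

lemma bounded_lipschitz_minus:
  "bounded_lipschitz S f \<Longrightarrow> bounded_lipschitz S (\<lambda>x. - f x)"
  using bounded_lipschitz_mult[OF bounded_lipschitz_const[of S "- 1"]] by simp

lemma bounded_lipschitz_diff:
  "bounded_lipschitz S f \<Longrightarrow> bounded_lipschitz S g \<Longrightarrow> bounded_lipschitz S (\<lambda>x. f x - g x)"
  using bounded_lipschitz_add[OF _ bounded_lipschitz_minus] by simp

lemma bounded_lipschitz_power:
  "bounded_lipschitz S f \<Longrightarrow> bounded_lipschitz S (\<lambda>x. f x ^ n)"
  by (induction n) (auto intro: bounded_lipschitz_const bounded_lipschitz_mult)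

lemma bounded_lipschitz_inverse:
  assumes "bounded_lipschitz S f" "d > 0" and d: "\<And>x. x \<in> S \<Longrightarrow> d \<le> f x"
  shows "bounded_lipschitz S (\<lambda>x. inverse (f x))"
proof -
  obtain L where L: "L-lipschitz_on S f"
    using assms unfolding bounded_lipschitz_def by blast
  have bound: "\<bar>inverse (f x)\<bar> \<le> inverse d" if "x \<in> S" for x
    using d[OF that] \<open>d > 0\<close> by simp
  have "(inverse d * inverse d * L)-lipschitz_on S (\<lambda>x. inverse (f x))"
  proof (rule lipschitz_onI)
    fix x y assume xy: "x \<in> S" "y \<in> S"
    have "inverse (f x) - inverse (f y) = inverse (f x) * inverse (f y) * (f y - f x)"
      using d[OF xy(1)] d[OF xy(2)] \<open>d > 0\<close> by (simp add: field_simps)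
    then have "\<bar>inverse (f x) - inverse (f y)\<bar>
        = \<bar>inverse (f x)\<bar> * \<bar>inverse (f y)\<bar> * \<bar>f x - f y\<bar>"
      by (simp add: abs_mult abs_minus_commute)
    also have "\<dots> \<le> inverse d * inverse d * (L * dist x y)"
      using bound[OF xy(1)] bound[OF xy(2)] lipschitz_onD[OF L xy] \<open>d > 0\<close>
      by (intro mult_mono) (auto simp: dist_real_def)
    finally show "dist (inverse (f x)) (inverse (f y)) \<le> inverse d * inverse d * L * dist x y"
      by (simp add: dist_real_def)
  qed (use lipschitz_on_nonneg[OF L] \<open>d > 0\<close> in simp)
  then show ?thesis
    unfolding bounded_lipschitz_def using bound by blast
qed

lemma bounded_lipschitz_sin_cos:
  assumes "bounded_lipschitz S f"
  shows "bounded_lipschitz S (\<lambda>x. sin (f x))" "bounded_lipschitz S (\<lambda>x. cos (f x))"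
proof -
  obtain L where L: "L-lipschitz_on S f"
    using assms unfolding bounded_lipschitz_def by blast
  have contraction: "\<bar>g x - g y\<bar> \<le> \<bar>x - y\<bar>"
    if "\<And>x. (g has_real_derivative g' x) (at x)" "\<And>x. \<bar>g' x\<bar> \<le> 1" for g g' :: "real \<Rightarrow> real" and x y
    using field_differentiable_bound[of UNIV g g' 1 x y] that by simp
  have sin: "\<bar>sin x - sin y\<bar> \<le> \<bar>x - y\<bar>" for x y :: real
    by (rule contraction[of sin cos]) (auto intro: DERIV_sin)
  have cos: "\<bar>cos x - cos y\<bar> \<le> \<bar>x - y\<bar>" for x y :: real
    by (rule contraction[of cos "\<lambda>x. - sin x"]) (auto intro: DERIV_cos)
  have "L-lipschitz_on S (\<lambda>x. g (f x))" if "\<And>x y. \<bar>g x - g y\<bar> \<le> \<bar>x - y\<bar>" for g :: "real \<Rightarrow> real"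
    using lipschitz_on_nonneg[OF L] order_trans[OF that] lipschitz_onD[OF L]
    by (intro lipschitz_onI) (auto simp: dist_real_def)
  from this[of sin] this[of cos] sin cos
  have "L-lipschitz_on S (\<lambda>x. sin (f x))" "L-lipschitz_on S (\<lambda>x. cos (f x))"
    by blast+
  moreover have "\<forall>x\<in>S. \<bar>sin (f x)\<bar> \<le> 1" "\<forall>x\<in>S. \<bar>cos (f x)\<bar> \<le> 1"
    by auto
  ultimately show "bounded_lipschitz S (\<lambda>x. sin (f x))" "bounded_lipschitz S (\<lambda>x. cos (f x))"
    unfolding bounded_lipschitz_def by blast+
qed

lemma bounded_lipschitz_linear:
  assumes "bounded S" "bounded_linear f"
  shows "bounded_lipschitz S f"
proof -
  have "\<exists>B. \<forall>x\<in>S. \<bar>f x\<bar> \<le> B"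
    using bounded_linear_image[OF assms] by (auto simp: bounded_iff)
  moreover have "\<exists>L. L-lipschitz_on S f"
    using bounded_linear.lipschitz_boundE[OF assms(2)] by metis
  ultimately show ?thesis
    by (simp add: bounded_lipschitz_def)
qed

section \<open>The Ziegler pendulum without springs\<close>

lemma sin_ge_half: "x / 2 \<le> sin x" if "0 \<le> x" "x \<le> 1" for x :: real
proof -
  have "sin 0 - 0 / 2 \<le> sin x - x / 2"
  proof (rule DERIV_nonneg_imp_nondecreasing[OF that(1)])
    fix y :: real assume "0 \<le> y" "y \<le> x"
    then have "cos (pi / 3) \<le> cos y"
      using that pi_gt3 by (intro cos_monotone_0_pi_le) auto
    then show "\<exists>D. ((\<lambda>x. sin x - x / 2) has_real_derivative D) (at y) \<and> 0 \<le> D"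
      by (intro exI[of _ "cos y - 1 / 2"]) (auto intro!: derivative_eq_intros simp: cos_60)
  qed
  then show ?thesis by simp
qed

locale ziegler =
  fixes F m1 m2 m3 l1 l2 l3 :: real
  assumes pos: "m1 > 0" "m2 > 0" "m3 > 0" "l1 > 0" "l2 > 0" "l3 > 0" and F_neg: "F < 0"
begin

text \<open>The static moment \<open>\<delta>\<close> couples the two angles: without it the first angle is a mathematical
  pendulum driven by the follower force.\<close>

definition "\<delta> = m1 * l1 - m3 * l3"
definition "a11 = A11 m1 m3 l1 l3"
definition "a12 = A12 m1 m3 l1 l2 l3"
definition "a22 = A22 m1 m2 m3 l1 l2 l3"
definition "mass_det \<phi> = a11 * a22 \<phi> - (a12 \<phi>)\<^sup>2"

text \<open>The factors of \<open>- sin \<phi>\<close> in the numerators of the two accelerations.\<close>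

definition "num1 \<phi> p q = a22 \<phi> * \<delta> * l2 * q\<^sup>2 + a12 \<phi> * (- F * l2 + \<delta> * l2 * p * (p + 2 * q))"
definition "num2 \<phi> p q = - a11 * (- F * l2 + \<delta> * l2 * p * (p + 2 * q)) - a12 \<phi> * \<delta> * l2 * q\<^sup>2"

lemma a11_pos: "a11 > 0"
  using pos by (simp add: a11_def A11_def add_pos_pos)

lemma a12_eq: "a12 \<phi> = a11 + \<delta> * l2 * cos \<phi>"
  by (simp add: a12_def A12_def a11_def A11_def \<delta>_def)

lemma a22_eq: "a22 \<phi> = (m1 + m2 + m3) * l2\<^sup>2 + a11 + 2 * \<delta> * l2 * cos \<phi>"
  by (simp add: a22_def A22_def a11_def A11_def \<delta>_def)

text \<open>This holds by \<open>\<delta>\<^sup>2 \<le> (m1 + m3) * a11\<close>, a form of the Cauchy--Schwarz inequality. A bound that is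
  uniform in \<open>\<phi>\<close> makes \<open>1 / mass_det\<close> Lipschitz.\<close>

lemma mass_det_lower_bound: "m2 * a11 * l2\<^sup>2 \<le> mass_det \<phi>"
proof -
  have "(m1 + m3) * a11 - \<delta>\<^sup>2 = m1 * m3 * (l1 + l3)\<^sup>2"
    by (simp add: a11_def A11_def \<delta>_def power2_eq_square algebra_simps)
  moreover have "m1 * m3 * (l1 + l3)\<^sup>2 \<ge> 0"
    using pos by simp
  ultimately have "\<delta>\<^sup>2 \<le> (m1 + m3) * a11" by linarith
  moreover have "\<delta>\<^sup>2 * (cos \<phi>)\<^sup>2 \<le> \<delta>\<^sup>2 * 1"
    by (intro mult_left_mono) (auto simp: abs_square_le_1)
  ultimately have "0 \<le> l2\<^sup>2 * ((m1 + m3) * a11 - \<delta>\<^sup>2 * (cos \<phi>)\<^sup>2)"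
    by simp
  also have "\<dots> = mass_det \<phi> - m2 * a11 * l2\<^sup>2"
    by (simp add: mass_det_def a12_eq a22_eq power2_eq_square algebra_simps)
  finally show ?thesis by simp
qed

lemma mass_det_pos: "mass_det \<phi> > 0"
proof -
  have "m2 * a11 * l2\<^sup>2 > 0"
    using pos a11_pos by simp
  then show ?thesis
    using mass_det_lower_bound[of \<phi>] by linarith
qed

lemma a22_pos: "a22 \<phi> > 0"
proof -
  have "a11 * a22 \<phi> = mass_det \<phi> + (a12 \<phi>)\<^sup>2"
    by (simp add: mass_det_def)
  then have "a11 * a22 \<phi> > 0"
    using mass_det_pos[of \<phi>] by (simp add: add_pos_nonneg)
  then show ?thesis
    using a11_pos by (simp add: zero_less_mult_iff)
qed

definition "acc1 \<phi> p q = - sin \<phi> * (num1 \<phi> p q * inverse (mass_det \<phi>))"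
definition "acc2 \<phi> p q = - sin \<phi> * (num2 \<phi> p q * inverse (mass_det \<phi>))"

lemma ziegler_field_eq:
  "ziegler_field F 0 m1 m2 m3 l1 l2 l3 = (\<lambda>(\<phi>, p, q). (p, acc1 \<phi> p q, acc2 \<phi> p q))"
proof (intro ext, clarify)
  fix \<phi> p q :: real
  have "a11 - (a12 \<phi>)\<^sup>2 / a22 \<phi> = mass_det \<phi> / a22 \<phi>" "a22 \<phi> - (a12 \<phi>)\<^sup>2 / a11 = mass_det \<phi> / a11"
    using a11_pos a22_pos[of \<phi>] by (simp_all add: mass_det_def field_simps)
  then show "ziegler_field F 0 m1 m2 m3 l1 l2 l3 (\<phi>, p, q) = (p, acc1 \<phi> p q, acc2 \<phi> p q)"
    using a11_pos a22_pos[of \<phi>] mass_det_pos[of \<phi>]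
    unfolding ziegler_field_def
    by (simp add: Let_def acc1_def acc2_def num1_def num2_def r1_def r2_def
        flip: a11_def a12_def a22_def \<delta>_def) (simp add: field_simps)
qed

lemma acc_bounded_lipschitz:
  assumes "bounded S"
  shows "bounded_lipschitz S (\<lambda>(\<phi>, p, q). acc1 \<phi> p q)"
    and "bounded_lipschitz S (\<lambda>(\<phi>, p, q). acc2 \<phi> p q)"
proof -
  have proj: "bounded_lipschitz S fst" "bounded_lipschitz S (\<lambda>z. fst (snd z))"
    "bounded_lipschitz S (\<lambda>z. snd (snd z))"
    by (intro bounded_lipschitz_linear assms bounded_linear_intros)+
  have inv: "bounded_lipschitz S (\<lambda>z. inverse (mass_det (fst z)))"
  proof (rule bounded_lipschitz_inverse)
    show "m2 * a11 * l2\<^sup>2 > 0"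
      using pos a11_pos by simp
    show "bounded_lipschitz S (\<lambda>z. mass_det (fst z))"
      unfolding mass_det_def a12_eq a22_eq
      by (intro bounded_lipschitz_add bounded_lipschitz_diff bounded_lipschitz_minus
          bounded_lipschitz_mult bounded_lipschitz_power
          bounded_lipschitz_const bounded_lipschitz_sin_cos proj)
  qed (rule mass_det_lower_bound)
  show "bounded_lipschitz S (\<lambda>(\<phi>, p, q). acc1 \<phi> p q)" "bounded_lipschitz S (\<lambda>(\<phi>, p, q). acc2 \<phi> p q)"
    unfolding split_beta acc1_def acc2_def num1_def num2_def a12_eq a22_eq
    by (intro bounded_lipschitz_add bounded_lipschitz_diff bounded_lipschitz_minus
          bounded_lipschitz_mult bounded_lipschitz_power
          bounded_lipschitz_const bounded_lipschitz_sin_cos proj inv)+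
qed

lemma field_lipschitz:
  assumes "bounded S"
  shows "\<exists>L. L-lipschitz_on S (\<lambda>(\<phi>, p, q). (p, acc1 \<phi> p q, acc2 \<phi> p q))"
proof -
  obtain L1 L2 where L: "L1-lipschitz_on S (\<lambda>(\<phi>, p, q). acc1 \<phi> p q)"
    "L2-lipschitz_on S (\<lambda>(\<phi>, p, q). acc2 \<phi> p q)"
    using acc_bounded_lipschitz[OF assms] unfolding bounded_lipschitz_def by blast
  obtain L0 where "L0-lipschitz_on S (\<lambda>z :: real \<times> real \<times> real. fst (snd z))"
    using bounded_linear.lipschitz_boundE[OF bounded_linear_compose[OF bounded_linear_fst bounded_linear_snd]]
    by metis
  from lipschitz_on_Pair[OF this lipschitz_on_Pair[OF L]] show ?thesis
    unfolding split_beta by blast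
qed

text \<open>Near \<open>\<phi> = c\<close> with \<open>sin c = 0\<close> the first acceleration is \<open>- sin (\<phi> - c)\<close> times
  \<open>cos c * num1 / mass_det\<close>; where this factor is positive, \<open>\<phi>\<close> oscillates about \<open>c\<close>.\<close>

lemma family_at_centre:
  assumes c: "sin c = 0" and positive: "cos c * num1 c 0 w > 0"
  shows "has_two_parameter_family_of_periodic_solutions (ziegler_field F 0 m1 m2 m3 l1 l2 l3)"
proof -
  define G where "G = (\<lambda>(\<phi>, p, q). cos c * (num1 \<phi> p q * inverse (mass_det \<phi>)))"
  have G0: "G (c, 0, w) > 0"
    using mult_pos_pos[OF positive, of "inverse (mass_det c)"] mass_det_pos[of c]
    by (simp add: G_def mult.assoc)
  have "mass_det (fst z) \<noteq> 0" for z :: "real \<times> real \<times> real"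
    using mass_det_pos[of "fst z"] by simp
  then have "isCont G (c, 0, w)"
    unfolding G_def split_beta num1_def mass_det_def a12_eq a22_eq
    by (intro continuous_intros) auto
  then obtain e where e: "e > 0" "\<And>z. dist z (c, 0, w) < e \<Longrightarrow> dist (G z) (G (c, 0, w)) < G (c, 0, w) / 2"
    using G0 unfolding continuous_at_eps_delta by (meson half_gt_zero)
  \<comment> \<open>\<open>r \<le> 1\<close> serves the bound \<open>x / 2 \<le> sin x\<close>, and \<open>3 * r < e\<close> puts the box into the ball of radius \<open>e\<close>.\<close>
  define r where "r = min 1 (e / 4)"
  have r: "r > 0" "r \<le> 1" "3 * r < e"
    using e(1) by (auto simp: r_def min_def)
  have G_lower: "G (\<phi>, p, q) \<ge> G (c, 0, w) / 2"
    if "\<bar>\<phi> - c\<bar> \<le> r" "\<bar>p\<bar> \<le> r" "\<bar>q - w\<bar> \<le> r" for \<phi> p q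
  proof -
    have "dist (\<phi>, p, q) (c, 0, w) \<le> \<bar>\<phi> - c\<bar> + sqrt (p\<^sup>2 + (q - w)\<^sup>2)"
      using sqrt_sum_squares_le_sum_abs[of "\<phi> - c" "sqrt (p\<^sup>2 + (q - w)\<^sup>2)"]
      by (simp add: dist_Pair_Pair dist_real_def)
    also have "\<dots> \<le> \<bar>\<phi> - c\<bar> + (\<bar>p\<bar> + \<bar>q - w\<bar>)"
      by (intro add_left_mono sqrt_sum_squares_le_sum_abs)
    also have "\<dots> < e"
      using that r by linarith
    finally show ?thesis
      using e(2)[of "(\<phi>, p, q)"] by (simp add: dist_real_def abs_if split: if_splits)
  qed
  \<comment> \<open>One factor \<open>1 / 2\<close> of the \<open>1 / 4\<close> comes from \<open>G\<close> and one from the sine.\<close>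
  define \<omega> where "\<omega> = sqrt (G (c, 0, w) / 4)"
  have \<omega>: "\<omega> > 0" "\<omega>\<^sup>2 = G (c, 0, w) / 4"
    using G0 by (simp_all add: \<omega>_def)
  have cos_c: "cos c * cos c = 1"
    using sin_cos_squared_add[of c] by (simp add: c power2_eq_square)
  have reflected: "sin (2 * c - \<phi>) = - sin \<phi>" "cos (2 * c - \<phi>) = cos \<phi>" for \<phi>
    using cos_c by (simp_all add: sin_diff cos_diff sin_double cos_double c power2_eq_square)
  have acc1: "acc1 \<phi> p q = - sin (\<phi> - c) * G (\<phi>, p, q)" for \<phi> p q
  proof -
    have "sin (\<phi> - c) * cos c = sin \<phi> * (cos c * cos c)"
      by (simp add: sin_diff c)
    then have "sin (\<phi> - c) * cos c = sin \<phi>"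
      by (simp add: cos_c)
    then show ?thesis
      by (simp add: acc1_def G_def flip: mult.assoc)
  qed
  have "bounded ({c - r..c + r} \<times> {-r..r} \<times> {w - r..w + r})"
    by (intro bounded_Times bounded_closed_interval)
  from field_lipschitz[OF this] obtain L where L: "L-lipschitz_on ({c - r..c + r} \<times> {-r..r} \<times> {w - r..w + r})
      (\<lambda>(\<phi>, p, q). (p, acc1 \<phi> p q, acc2 \<phi> p q))" by blast
  interpret reversible_centre acc1 acc2 c w r L \<omega>
  proof
    show "acc1 (2 * c - \<phi>) p q = - acc1 \<phi> p q" "acc2 (2 * c - \<phi>) p q = - acc2 \<phi> p q" for \<phi> p q
      by (simp_all add: acc1_def acc2_def num1_def num2_def mass_det_def a12_eq a22_eq reflected)
    fix \<phi> p q
    assume box: "c \<le> \<phi>" "\<phi> \<le> c + r" "\<bar>p\<bar> \<le> r" "\<bar>q - w\<bar> \<le> r"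
    have "(\<phi> - c) / 2 * (G (c, 0, w) / 2) \<le> sin (\<phi> - c) * G (\<phi>, p, q)"
      using box r G0 sin_ge_half[of "\<phi> - c"] G_lower[of \<phi> p q] by (intro mult_mono) auto
    then show "acc1 \<phi> p q \<le> - \<omega>\<^sup>2 * (\<phi> - c)"
      by (simp add: acc1 \<omega>(2) algebra_simps)
  qed (fact r \<omega> L)+
  show ?thesis
    using two_parameter_family by (simp add: field_def ziegler_field_eq)
qed

text \<open>For \<open>\<delta> \<ge> 0\<close> the follower force alone stabilises \<open>\<phi> = 0\<close>, because \<open>a12 0 > 0\<close>. For \<open>\<delta> < 0\<close>
  the inertia \<open>a12 0\<close> can have either sign, and the opposite position \<open>\<phi> = pi\<close> is used: a fast
  rotation \<open>w\<close> makes the centrifugal term \<open>a22 * \<bar>\<delta>\<bar> * l2 * w\<^sup>2\<close> outweigh the follower force.\<close>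

lemma family_exists:
  "has_two_parameter_family_of_periodic_solutions (ziegler_field F 0 m1 m2 m3 l1 l2 l3)"
proof (cases "\<delta> \<ge> 0")
  case True
  then have "a12 0 > 0"
    using a11_pos pos by (simp add: a12_eq add_pos_nonneg)
  then have "cos 0 * num1 0 0 0 > 0"
    using pos F_neg by (simp add: num1_def mult_pos_neg mult_neg_pos)
  then show ?thesis
    by (intro family_at_centre[of 0 0]) auto
next
  case False
  define k where "k = a22 pi * (- \<delta>) * l2"
  have k: "k > 0"
    using False a22_pos[of pi] pos by (simp add: k_def mult_pos_neg mult_neg_pos)
  \<comment> \<open>Chosen such that \<open>k * w\<^sup>2\<close> exceeds the force term by \<open>k\<close>.\<close>
  define w where "w = sqrt (\<bar>a12 pi * F * l2\<bar> / k + 1)"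
  have "w\<^sup>2 = \<bar>a12 pi * F * l2\<bar> / k + 1"
    using k by (simp add: w_def)
  then have "k * w\<^sup>2 = \<bar>a12 pi * F * l2\<bar> + k"
    using k by (simp add: field_simps)
  moreover have "cos pi * num1 pi 0 w = k * w\<^sup>2 + a12 pi * F * l2"
    by (simp add: num1_def k_def)
  ultimately have "cos pi * num1 pi 0 w > 0"
    using k by linarith
  then show ?thesis
    by (intro family_at_centre[of pi w]) auto
qed

end

theorem proposition11:
  fixes F k1 :: real
  assumes "k1 = 0" and "F < 0"
  shows "\<exists>\<epsilon>>0. \<forall>m1 m2 m3 l1 l2 l3 :: real.
           m1 > 0 \<and> m2 > 0 \<and> m3 > 0 \<and> l1 > 0 \<and> l2 > 0 \<and> l3 > 0 \<and>
           \<bar>m1 * l1 - m3 * l3\<bar> < \<epsilon> \<longrightarrow>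
           has_two_parameter_family_of_periodic_solutions (ziegler_field F k1 m1 m2 m3 l1 l2 l3)"
proof (intro exI[of _ "1 :: real"] conjI allI impI)
  fix m1 m2 m3 l1 l2 l3 :: real
  assume "m1 > 0 \<and> m2 > 0 \<and> m3 > 0 \<and> l1 > 0 \<and> l2 > 0 \<and> l3 > 0 \<and>
           \<bar>m1 * l1 - m3 * l3\<bar> < 1"
  with assms(2) interpret ziegler F m1 m2 m3 l1 l2 l3
    by unfold_locales auto
  show "has_two_parameter_family_of_periodic_solutions (ziegler_field F k1 m1 m2 m3 l1 l2 l3)"
    unfolding assms(1) by (rule family_exists)
qed simp

end
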